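(* Let $\mathsf{C}$ be a category of groups with operations. Let $\widetilde G$ be a groupoid and let $G$ be an internal groupoid in $\mathsf{C}$ whose underlying groupoid is transitive; let $0\in G_0$ be the identity of the additive operation and let $\tilde 0\in\widetilde G_0$. Suppose that $p\colon(\widetilde G,\tilde 0)\rightarrow (G,0)$ is a covering morphism of underlying groupoids such that the characteristic group $C=p(\widetilde G(\tilde 0))$ of $p$ at $\tilde 0$ is a subobject (in $\mathsf{C}$) of $G(0)$. Then the internal groupoid structure of $G$ lifts to $\widetilde G$ with identity $\tilde 0$; that is, the groupoid $\widetilde G$ becomes an internal groupoid in $\mathsf{C}$ such that $p$ is a morphism of internal groupoids in $\mathsf{C}$ and $\tilde 0$ is the identity of the additive operation on $\widetilde G_0$.
   Context: Groupoids. A groupoid $G$ is a small category in which every morphism is an isomorphism. It has a set of morphisms (called elements), also denoted $G$, a set of objects $G_0$, initial and final point maps $d_0,d_1\colon G\to G_0$, and an object inclusion $\epsilon\colon G_0\to G$, where $\epsilon(x)$ is the identity at $x$. The composite $a\circ b$ is defined when $d_1(a)=d_0(b)$, and then $d_0(a\circ b)=d_0(a)$, $d_1(a\circ b)=d_1(b)$. $G(x,y)$ is the set of elements with initial point $x$ and final point $y$; $G(x)=G(x,x)$ is the object group at $x$; $St_G x=\{a\in G: d_0(a)=x\}$ is the star of $x$. $G$ is transitive if $G(x,y)\neq\emptyset$ for all $x,y\in G_0$. A morphism of groupoids is a pair of maps on elements and on objects compatible with $d_0$, $d_1$, $\epsilon$ and composition. A morphism $p\colon\widetilde G\to G$ of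 groupoids is a covering morphism if for each $\tilde x\in\widetilde G_0$ the restriction $St_{\widetilde G}\tilde x\to St_G p(\tilde x)$ is bijective; a covering morphism $p\colon(\widetilde G,\tilde x)\to(G,x)$ of pointed groupoids is a covering morphism with $p(\tilde x)=x$. The characteristic group of $p$ at $\tilde x$ is the subgroup $p(\widetilde G(\tilde x))$ of $G(p\tilde x)$. Groups with operations. A category of groups with operations $\mathsf{C}$ is the category of groups equipped with a set of operations $\Omega$ satisfying a set of identities $\mathsf{E}$, where $\mathsf{E}$ includes the group laws and, with $\Omega_i$ the set of $i$-ary operations: (a) $\Omega=\Omega_0\cup\Omega_1\cup\Omega_2$; (b) the group operations, written additively (but not assumed commutative) $0,-,+$, are elements of $\Omega_0,\Omega_1,\Omega_2$ respectively; put $\Omega_2'=\Omega_2\setminus\{+\}$, $\Omega_1'=\Omega_1\setminus\{-\}$; if $\star\in\Omega_2'$ then $\star^\circ$, defined by $a\star^\circ b=b\star a$, is also in $\Omega_2'$; and $\Omega_0=\{0\}$; (c) for each $\star\in\Omega_2'$, $\mathsf{E}$ includes $a\star(b+c)=a\star b+a\star c$; (d) for each $\omega\in\Omega_1'$ and $\star\in\Omega_2'$, $\mathsf{E}$ includes $\omega(a+b)=\omega(a)+\omega(b)$ and $\omega(a)\star b=\omega(a\star b)$. Morphisms are group homomorphisms preserving the operations in $\Omega_1'$ and $\Omega_2'$. Objects of $\mathsf{C}$ are called groups with operations. Internal groupoids. An internal groupoid (equivalently, internal category) $G$ in $\mathsf{C}$ is a category (automatically a groupoid) in which $G$ and $G_0$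 are objects of $\mathsf{C}$ and $d_0,d_1\colon G\to G_0$, $\epsilon\colon G_0\to G$ and the partial composition $\circ\colon G_{d_1}\times_{d_0}G\to G$, defined on the pullback of $d_1$ and $d_0$, are morphisms in $\mathsf{C}$. A morphism of internal groupoids is a morphism of the underlying groupoids which is also a morphism in $\mathsf{C}$. For an internal groupoid $G$, the object group $G(0)$ is an object of $\mathsf{C}$ under the operations restricted from $G$.
   Formalization: The covering groupoid G̃ is additionally assumed transitive; without this the claim fails, e.g. for groups with x+x=0, G trivial and G̃ the discrete groupoid on three objects. *)

theory Defs
  imports "HOL-Algebra.Group"
begin

section \<open>Categories of groups with operations\<close>

text \<open>
  Terms over the operations \<open>0, -, +\<close>, further unary operations named in \<open>'u\<close> and further
  binary operations named in \<open>'b\<close>. There are no other constants.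
\<close>

datatype ('u, 'b) gterm =
    TVar nat
  | TZero
  | TNeg "('u, 'b) gterm"
  | TPlus "('u, 'b) gterm" "('u, 'b) gterm"
  | TUn 'u "('u, 'b) gterm"
  | TBin 'b "('u, 'b) gterm" "('u, 'b) gterm"

primrec wf_gterm :: "'u set \<Rightarrow> 'b set \<Rightarrow> ('u, 'b) gterm \<Rightarrow> bool" where
  "wf_gterm U B (TVar n) \<longleftrightarrow> True"
| "wf_gterm U B TZero \<longleftrightarrow> True"
| "wf_gterm U B (TNeg s) \<longleftrightarrow> wf_gterm U B s"
| "wf_gterm U B (TPlus s t) \<longleftrightarrow> wf_gterm U B s \<and> wf_gterm U B t"
| "wf_gterm U B (TUn w s) \<longleftrightarrow> w \<in> U \<and> wf_gterm U B s"
| "wf_gterm U B (TBin f s t) \<longleftrightarrow> f \<in> B \<and> wf_gterm U B s \<and> wf_gterm U B t"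

text \<open>
  \<open>unary_ops\<close> and \<open>binary_ops\<close> are the operations other than \<open>-\<close> and \<open>+\<close>
  (\<open>\<Omega>\<^sub>1'\<close> and \<open>\<Omega>\<^sub>2'\<close>); \<open>identities\<close> is the set \<open>E\<close>, an identity being a pair of terms.
\<close>

record ('u, 'b) gwo_theory =
  unary_ops :: "'u set"
  binary_ops :: "'b set"
  identities :: "(('u, 'b) gterm \<times> ('u, 'b) gterm) set"

definition group_laws :: "(('u, 'b) gterm \<times> ('u, 'b) gterm) set" where
  "group_laws =
    (let x = TVar 0; y = TVar 1; z = TVar 2 in
      {(TPlus (TPlus x y) z, TPlus x (TPlus y z)),
       (TPlus TZero x, x), (TPlus x TZero, x),
       (TPlus (TNeg x) x, TZero), (TPlus x (TNeg x), TZero)})"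

locale groups_with_operations =
  fixes C :: "('u, 'b) gwo_theory"
  assumes wf: "\<lbrakk>(s, t) \<in> identities C\<rbrakk> \<Longrightarrow>
      wf_gterm (unary_ops C) (binary_ops C) s \<and> wf_gterm (unary_ops C) (binary_ops C) t"
    and group_laws: "group_laws \<subseteq> identities C"
    and opposite: "f \<in> binary_ops C \<Longrightarrow> \<exists>g \<in> binary_ops C.
      (TBin g (TVar 0) (TVar 1), TBin f (TVar 1) (TVar 0)) \<in> identities C"
    and distrib: "f \<in> binary_ops C \<Longrightarrow>
      (TBin f (TVar 0) (TPlus (TVar 1) (TVar 2)),
       TPlus (TBin f (TVar 0) (TVar 1)) (TBin f (TVar 0) (TVar 2))) \<in> identities C"
    and unary_additive: "w \<in> unary_ops C \<Longrightarrow>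
      (TUn w (TPlus (TVar 0) (TVar 1)),
       TPlus (TUn w (TVar 0)) (TUn w (TVar 1))) \<in> identities C"
    and unary_binary: "\<lbrakk>w \<in> unary_ops C; f \<in> binary_ops C\<rbrakk> \<Longrightarrow>
      (TBin f (TUn w (TVar 0)) (TVar 1),
       TUn w (TBin f (TVar 0) (TVar 1))) \<in> identities C"

text \<open>
  The additive group is the underlying HOL-Algebra group: \<open>a + b\<close> is \<open>a \<otimes> b\<close>, \<open>0\<close> is \<open>\<one>\<close>
  and \<open>-a\<close> is \<open>inv a\<close>. It need not be commutative.
\<close>

record ('a, 'u, 'b) gwo = "'a monoid" +
  un :: "'u \<Rightarrow> 'a \<Rightarrow> 'a"
  bin :: "'b \<Rightarrow> 'a \<Rightarrow> 'a \<Rightarrow> 'a"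

primrec gterm_eval :: "('a, 'u, 'b) gwo \<Rightarrow> (nat \<Rightarrow> 'a) \<Rightarrow> ('u, 'b) gterm \<Rightarrow> 'a" where
  "gterm_eval A v (TVar n) = v n"
| "gterm_eval A v TZero = \<one>\<^bsub>A\<^esub>"
| "gterm_eval A v (TNeg s) = inv\<^bsub>A\<^esub> (gterm_eval A v s)"
| "gterm_eval A v (TPlus s t) = gterm_eval A v s \<otimes>\<^bsub>A\<^esub> gterm_eval A v t"
| "gterm_eval A v (TUn w s) = un A w (gterm_eval A v s)"
| "gterm_eval A v (TBin f s t) = bin A f (gterm_eval A v s) (gterm_eval A v t)"

definition closed_ops :: "('u, 'b) gwo_theory \<Rightarrow> ('a, 'u, 'b) gwo \<Rightarrow> 'a set \<Rightarrow> bool" where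
  "closed_ops C A H \<longleftrightarrow>
    (\<forall>w \<in> unary_ops C. \<forall>a \<in> H. un A w a \<in> H) \<and>
    (\<forall>f \<in> binary_ops C. \<forall>a \<in> H. \<forall>b \<in> H. bin A f a b \<in> H)"

definition gwo_object :: "('u, 'b) gwo_theory \<Rightarrow> ('a, 'u, 'b) gwo \<Rightarrow> bool" where
  "gwo_object C A \<longleftrightarrow>
    group A \<and> closed_ops C A (carrier A) \<and>
    (\<forall>(s, t) \<in> identities C. \<forall>v. (\<forall>n. v n \<in> carrier A) \<longrightarrow>
      gterm_eval A v s = gterm_eval A v t)"

definition gwo_hom ::
  "('u, 'b) gwo_theory \<Rightarrow> ('a, 'u, 'b) gwo \<Rightarrow> ('c, 'u, 'b) gwo \<Rightarrow> ('a \<Rightarrow> 'c) set" where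
  "gwo_hom C A B = {h \<in> hom A B.
    (\<forall>w \<in> unary_ops C. \<forall>a \<in> carrier A. h (un A w a) = un B w (h a)) \<and>
    (\<forall>f \<in> binary_ops C. \<forall>a \<in> carrier A. \<forall>b \<in> carrier A.
      h (bin A f a b) = bin B f (h a) (h b))}"

definition gwo_subobject ::
  "('u, 'b) gwo_theory \<Rightarrow> 'a set \<Rightarrow> ('a, 'u, 'b) gwo \<Rightarrow> bool" where
  "gwo_subobject C H A \<longleftrightarrow> subgroup H A \<and> closed_ops C A H"

definition gwo_restrict :: "('a, 'u, 'b) gwo \<Rightarrow> 'a set \<Rightarrow> ('a, 'u, 'b) gwo" where
  "gwo_restrict A H = A\<lparr>carrier := H\<rparr>"

definition gwo_prod ::
  "('a, 'u, 'b) gwo \<Rightarrow> ('c, 'u, 'b) gwo \<Rightarrow> ('a \<times> 'c, 'u, 'b) gwo" where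
  "gwo_prod A B =
    \<lparr>carrier = carrier A \<times> carrier B,
     mult = (\<lambda>(a, b) (a', b'). (a \<otimes>\<^bsub>A\<^esub> a', b \<otimes>\<^bsub>B\<^esub> b')),
     one = (\<one>\<^bsub>A\<^esub>, \<one>\<^bsub>B\<^esub>),
     un = (\<lambda>w (a, b). (un A w a, un B w b)),
     bin = (\<lambda>f (a, b) (a', b'). (bin A f a a', bin B f b b'))\<rparr>"


section \<open>Groupoids and covering morphisms\<close>

record ('a, 'o) groupoid_data =
  elts :: "'a set"
  objs :: "'o set"
  d0 :: "'a \<Rightarrow> 'o"
  d1 :: "'a \<Rightarrow> 'o"
  eps :: "'o \<Rightarrow> 'a"
  cmp :: "'a \<Rightarrow> 'a \<Rightarrow> 'a"

text \<open>
  Composition is in diagrammatic order; \<open>cmp G a b\<close> is meaningful only if \<open>d1 G a = d0 G b\<close>.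
\<close>

locale groupoid =
  fixes G :: "('a, 'o) groupoid_data"
  assumes d0_closed: "a \<in> elts G \<Longrightarrow> d0 G a \<in> objs G"
    and d1_closed: "a \<in> elts G \<Longrightarrow> d1 G a \<in> objs G"
    and eps_closed: "x \<in> objs G \<Longrightarrow> eps G x \<in> elts G"
    and d0_eps: "x \<in> objs G \<Longrightarrow> d0 G (eps G x) = x"
    and d1_eps: "x \<in> objs G \<Longrightarrow> d1 G (eps G x) = x"
    and cmp_closed: "\<lbrakk>a \<in> elts G; b \<in> elts G; d1 G a = d0 G b\<rbrakk> \<Longrightarrow> cmp G a b \<in> elts G"
    and d0_cmp: "\<lbrakk>a \<in> elts G; b \<in> elts G; d1 G a = d0 G b\<rbrakk> \<Longrightarrow> d0 G (cmp G a b) = d0 G a"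
    and d1_cmp: "\<lbrakk>a \<in> elts G; b \<in> elts G; d1 G a = d0 G b\<rbrakk> \<Longrightarrow> d1 G (cmp G a b) = d1 G b"
    and cmp_assoc: "\<lbrakk>a \<in> elts G; b \<in> elts G; c \<in> elts G; d1 G a = d0 G b; d1 G b = d0 G c\<rbrakk> \<Longrightarrow>
      cmp G (cmp G a b) c = cmp G a (cmp G b c)"
    and eps_cmp: "a \<in> elts G \<Longrightarrow> cmp G (eps G (d0 G a)) a = a"
    and cmp_eps: "a \<in> elts G \<Longrightarrow> cmp G a (eps G (d1 G a)) = a"
    and inverse: "a \<in> elts G \<Longrightarrow> \<exists>b \<in> elts G. d0 G b = d1 G a \<and> d1 G b = d0 G a \<and>
      cmp G a b = eps G (d0 G a) \<and> cmp G b a = eps G (d1 G a)"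

definition hom_set :: "('a, 'o) groupoid_data \<Rightarrow> 'o \<Rightarrow> 'o \<Rightarrow> 'a set" where
  "hom_set G x y = {a \<in> elts G. d0 G a = x \<and> d1 G a = y}"

abbreviation object_group :: "('a, 'o) groupoid_data \<Rightarrow> 'o \<Rightarrow> 'a set" where
  "object_group G x \<equiv> hom_set G x x"

definition star :: "('a, 'o) groupoid_data \<Rightarrow> 'o \<Rightarrow> 'a set" where
  "star G x = {a \<in> elts G. d0 G a = x}"

definition transitive_groupoid :: "('a, 'o) groupoid_data \<Rightarrow> bool" where
  "transitive_groupoid G \<longleftrightarrow> (\<forall>x \<in> objs G. \<forall>y \<in> objs G. hom_set G x y \<noteq> {})"

text \<open>
  Lifting an internal groupoid structure along a covering morphism needs the covering groupoid to
  be transitive as well: the characteristic group at one object says nothing about the other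
  components. For instance, a discrete groupoid with three objects covers the trivial groupoid,
  but three objects carry no group structure satisfying the identity \<open>x + x = 0\<close>.
\<close>

text \<open>A morphism is a pair of maps: \<open>p\<close> on elements and \<open>p0\<close> on objects.\<close>

definition groupoid_morphism ::
  "('a, 'o) groupoid_data \<Rightarrow> ('c, 'q) groupoid_data \<Rightarrow> ('a \<Rightarrow> 'c) \<Rightarrow> ('o \<Rightarrow> 'q) \<Rightarrow> bool" where
  "groupoid_morphism H G p p0 \<longleftrightarrow>
    (\<forall>a \<in> elts H. p a \<in> elts G \<and> d0 G (p a) = p0 (d0 H a) \<and> d1 G (p a) = p0 (d1 H a)) \<and>
    (\<forall>x \<in> objs H. p0 x \<in> objs G \<and> p (eps H x) = eps G (p0 x)) \<and>
    (\<forall>a \<in> elts H. \<forall>b \<in> elts H. d1 H a = d0 H b \<longrightarrow> p (cmp H a b) = cmp G (p a) (p b))"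

definition covering_morphism ::
  "('a, 'o) groupoid_data \<Rightarrow> ('c, 'q) groupoid_data \<Rightarrow> ('a \<Rightarrow> 'c) \<Rightarrow> ('o \<Rightarrow> 'q) \<Rightarrow> bool" where
  "covering_morphism H G p p0 \<longleftrightarrow>
    groupoid_morphism H G p p0 \<and> (\<forall>x \<in> objs H. bij_betw p (star H x) (star G (p0 x)))"

definition pointed_covering_morphism ::
  "('a, 'o) groupoid_data \<Rightarrow> 'o \<Rightarrow> ('c, 'q) groupoid_data \<Rightarrow> 'q \<Rightarrow> ('a \<Rightarrow> 'c) \<Rightarrow> ('o \<Rightarrow> 'q) \<Rightarrow> bool"
  where
  "pointed_covering_morphism H x G y p p0 \<longleftrightarrow>
    x \<in> objs H \<and> y \<in> objs G \<and> covering_morphism H G p p0 \<and> p0 x = y"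

definition characteristic_group ::
  "('a, 'o) groupoid_data \<Rightarrow> ('a \<Rightarrow> 'c) \<Rightarrow> 'o \<Rightarrow> 'c set" where
  "characteristic_group H p x = p ` object_group H x"


section \<open>Internal groupoids\<close>

text \<open>
  An internal groupoid is a groupoid \<open>G\<close> with operations \<open>A\<close> on its set of elements and
  operations \<open>A0\<close> on its set of objects.
\<close>

definition composable_pairs ::
  "('a, 'o) groupoid_data \<Rightarrow> ('a, 'u, 'b) gwo \<Rightarrow> ('a \<times> 'a, 'u, 'b) gwo" where
  "composable_pairs G A =
    gwo_restrict (gwo_prod A A) {(a, b). a \<in> elts G \<and> b \<in> elts G \<and> d1 G a = d0 G b}"

definition internal_groupoid ::
  "('u, 'b) gwo_theory \<Rightarrow> ('a, 'o) groupoid_data \<Rightarrow> ('a, 'u, 'b) gwo \<Rightarrow> ('o, 'u, 'b) gwo \<Rightarrow> bool"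
  where
  "internal_groupoid C G A A0 \<longleftrightarrow>
    groupoid G \<and>
    gwo_object C A \<and> carrier A = elts G \<and>
    gwo_object C A0 \<and> carrier A0 = objs G \<and>
    d0 G \<in> gwo_hom C A A0 \<and> d1 G \<in> gwo_hom C A A0 \<and>
    eps G \<in> gwo_hom C A0 A \<and>
    (\<lambda>(a, b). cmp G a b) \<in> gwo_hom C (composable_pairs G A) A"

definition internal_groupoid_morphism ::
  "('u, 'b) gwo_theory \<Rightarrow>
   ('a, 'o) groupoid_data \<Rightarrow> ('a, 'u, 'b) gwo \<Rightarrow> ('o, 'u, 'b) gwo \<Rightarrow>
   ('c, 'q) groupoid_data \<Rightarrow> ('c, 'u, 'b) gwo \<Rightarrow> ('q, 'u, 'b) gwo \<Rightarrow>
   ('a \<Rightarrow> 'c) \<Rightarrow> ('o \<Rightarrow> 'q) \<Rightarrow> bool" where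
  "internal_groupoid_morphism C H B B0 G A A0 p p0 \<longleftrightarrow>
    groupoid_morphism H G p p0 \<and> p \<in> gwo_hom C B A \<and> p0 \<in> gwo_hom C B0 A0"

end

theory Submission
  imports Defs
begin

text \<open>
  Write \<open>H\<close> for the covering groupoid and \<open>z\<close> for its base point. As \<open>H\<close> is transitive, every object of
  \<open>H\<close> is the end of an element starting at \<open>z\<close>, that is, of the lift of some element \<open>a\<close> of the star of \<open>0\<close> in \<open>G\<close>; two elements \<open>a\<close>,
  \<open>b\<close> have the same endpoint if and only if \<open>a = c \<circ> b\<close> for some \<open>c\<close> in the characteristic group
  (\<open>endpoint_eq_iff\<close>). Thus the objects of \<open>H\<close> are the cosets of the characteristic group in the
  star. This star is the kernel of \<open>d0\<close>, hence a group with operations, and the interchange law turns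
  \<open>(c \<circ> a') + (e \<circ> b')\<close> into \<open>(c + e) \<circ> (a' + b')\<close>, and likewise for all other operations. Since the
  characteristic group is closed under the operations, \<open>c + e\<close> lies in it again: the
  equivalence is a congruence (\<open>endpoint_congruence\<close>), and the operations descend to the objects of \<open>H\<close>.

  An element of \<open>H\<close> is determined by its initial point and its image under \<open>p\<close>, so it is the lift of \<open>g\<close>
  at \<open>endpoint a\<close> for some composable pair \<open>(a, g)\<close> with \<open>a\<close> in the star of \<open>0\<close>. These pairs form
  a pullback of groups with operations, and the operations descend along this second surjection
  because they do so on each of the two coordinates.

  It remains to see that the structure maps are homomorphisms. A map out of a quotient is one as soon
  as its composite with the projection is (\<open>gwo_hom_factor\<close>); this settles \<open>p\<close>, \<open>p0\<close>, \<open>d0\<close>, and \<open>d1\<close>, the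
  last because the lift of \<open>g\<close> at \<open>endpoint a\<close> ends at \<open>endpoint (a \<circ> g)\<close>. A map into the
  elements of \<open>H\<close> is one as soon as its composites with \<open>d0\<close> and \<open>p\<close> are
  (\<open>gwo_hom_jointly_injective\<close>); this settles \<open>eps\<close> and the composition.
\<close>

section \<open>Constructions on groups with operations\<close>

lemma gwo_restrict_simps [simp]:
  "carrier (gwo_restrict A S) = S"
  "mult (gwo_restrict A S) = mult A"
  "one (gwo_restrict A S) = one A"
  "un (gwo_restrict A S) = un A"
  "bin (gwo_restrict A S) = bin A"
  by (simp_all add: gwo_restrict_def)

lemma gwo_prod_simps [simp]:
  "carrier (gwo_prod A B) = carrier A \<times> carrier B"
  "mult (gwo_prod A B) s t = (fst s \<otimes>\<^bsub>A\<^esub> fst t, snd s \<otimes>\<^bsub>B\<^esub> snd t)"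
  "one (gwo_prod A B) = (\<one>\<^bsub>A\<^esub>, \<one>\<^bsub>B\<^esub>)"
  "un (gwo_prod A B) w s = (un A w (fst s), un B w (snd s))"
  "bin (gwo_prod A B) f s t = (bin A f (fst s) (fst t), bin B f (snd s) (snd t))"
  by (simp_all add: gwo_prod_def case_prod_beta)

lemma gwo_objectD:
  assumes "gwo_object C A"
  shows "group A"
    and "\<lbrakk>w \<in> unary_ops C; a \<in> carrier A\<rbrakk> \<Longrightarrow> un A w a \<in> carrier A"
    and "\<lbrakk>f \<in> binary_ops C; a \<in> carrier A; b \<in> carrier A\<rbrakk> \<Longrightarrow> bin A f a b \<in> carrier A"
    and "\<lbrakk>(s, t) \<in> identities C; \<And>n. v n \<in> carrier A\<rbrakk> \<Longrightarrow> gterm_eval A v s = gterm_eval A v t"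
  using assms unfolding gwo_object_def closed_ops_def by fast+

lemma gwo_homI:
  assumes "\<And>a. a \<in> carrier A \<Longrightarrow> h a \<in> carrier B"
    and "\<And>a b. \<lbrakk>a \<in> carrier A; b \<in> carrier A\<rbrakk> \<Longrightarrow> h (a \<otimes>\<^bsub>A\<^esub> b) = h a \<otimes>\<^bsub>B\<^esub> h b"
    and "\<And>w a. \<lbrakk>w \<in> unary_ops C; a \<in> carrier A\<rbrakk> \<Longrightarrow> h (un A w a) = un B w (h a)"
    and "\<And>f a b. \<lbrakk>f \<in> binary_ops C; a \<in> carrier A; b \<in> carrier A\<rbrakk> \<Longrightarrow>
      h (bin A f a b) = bin B f (h a) (h b)"
  shows "h \<in> gwo_hom C A B"
  using assms by (auto simp: gwo_hom_def hom_def)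

lemma gwo_homD:
  assumes "h \<in> gwo_hom C A B"
  shows "a \<in> carrier A \<Longrightarrow> h a \<in> carrier B"
    and "\<lbrakk>a \<in> carrier A; b \<in> carrier A\<rbrakk> \<Longrightarrow> h (a \<otimes>\<^bsub>A\<^esub> b) = h a \<otimes>\<^bsub>B\<^esub> h b"
    and "\<lbrakk>w \<in> unary_ops C; a \<in> carrier A\<rbrakk> \<Longrightarrow> h (un A w a) = un B w (h a)"
    and "\<lbrakk>f \<in> binary_ops C; a \<in> carrier A; b \<in> carrier A\<rbrakk> \<Longrightarrow>
      h (bin A f a b) = bin B f (h a) (h b)"
  using assms by (auto simp: gwo_hom_def hom_def)

lemma gwo_hom_one:
  assumes "gwo_object C A" "gwo_object C B" "h \<in> gwo_hom C A B"
  shows "h \<one>\<^bsub>A\<^esub> = \<one>\<^bsub>B\<^esub>"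
  using assms hom_one[of h A B] by (simp add: gwo_hom_def gwo_objectD(1))

lemma gwo_hom_inv:
  assumes "gwo_object C A" "gwo_object C B" "h \<in> gwo_hom C A B" "a \<in> carrier A"
  shows "h (inv\<^bsub>A\<^esub> a) = inv\<^bsub>B\<^esub> (h a)"
proof -
  have "group_hom A B h"
    using assms by (auto simp: group_hom_def group_hom_axioms_def gwo_hom_def gwo_objectD(1))
  then show ?thesis using assms(4) by (rule group_hom.hom_inv)
qed

lemma gwo_hom_comp:
  assumes "h \<in> gwo_hom C A B" "k \<in> gwo_hom C B D"
  shows "(\<lambda>a. k (h a)) \<in> gwo_hom C A D"
  using gwo_homD[OF assms(1)] gwo_homD[OF assms(2)] by (intro gwo_homI) simp_all

lemma gwo_hom_restrict:
  assumes "h \<in> gwo_hom C A B" "S \<subseteq> carrier A"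
  shows "h \<in> gwo_hom C (gwo_restrict A S) B"
  using gwo_homD[OF assms(1)] assms(2) by (intro gwo_homI) (auto simp: subset_iff)

lemma gwo_hom_cong:
  assumes A: "gwo_object C A" and h: "h \<in> gwo_hom C A B"
    and eq: "\<And>a. a \<in> carrier A \<Longrightarrow> k a = h a"
  shows "k \<in> gwo_hom C A B"
proof -
  interpret A: group A by (rule gwo_objectD(1)[OF A])
  show ?thesis
    using gwo_homD[OF h] gwo_objectD(2,3)[OF A] by (intro gwo_homI) (simp_all add: eq)
qed

lemma gwo_hom_fst: "fst \<in> gwo_hom C (gwo_prod A B) A"
  by (intro gwo_homI) auto

lemma gwo_hom_snd: "snd \<in> gwo_hom C (gwo_prod A B) B"
  by (intro gwo_homI) auto

text \<open>
  Additivity gives \<open>\<omega>(0) = \<omega>(0) + \<omega>(0)\<close> and \<open>0 \<star> 0 = 0 \<star> 0 + 0 \<star> 0\<close>. So the zero map is a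
  morphism, and kernels are equalizers.
\<close>

lemma (in groups_with_operations) zero_preserved:
  assumes A: "gwo_object C A"
  shows "w \<in> unary_ops C \<Longrightarrow> un A w \<one>\<^bsub>A\<^esub> = \<one>\<^bsub>A\<^esub>"
    and "f \<in> binary_ops C \<Longrightarrow> bin A f \<one>\<^bsub>A\<^esub> \<one>\<^bsub>A\<^esub> = \<one>\<^bsub>A\<^esub>"
proof -
  interpret A: group A by (rule gwo_objectD(1)[OF A])
  show "un A w \<one>\<^bsub>A\<^esub> = \<one>\<^bsub>A\<^esub>" if w: "w \<in> unary_ops C"
    using gwo_objectD(4)[OF A unary_additive[OF w], of "\<lambda>_. \<one>\<^bsub>A\<^esub>"]
      gwo_objectD(2)[OF A w A.one_closed] by simp
  show "bin A f \<one>\<^bsub>A\<^esub> \<one>\<^bsub>A\<^esub> = \<one>\<^bsub>A\<^esub>" if f: "f \<in> binary_ops C"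
    using gwo_objectD(4)[OF A distrib[OF f], of "\<lambda>_. \<one>\<^bsub>A\<^esub>"]
      gwo_objectD(3)[OF A f A.one_closed A.one_closed] by simp
qed

lemma (in groups_with_operations) gwo_hom_zero:
  assumes "gwo_object C B"
  shows "(\<lambda>_. \<one>\<^bsub>B\<^esub>) \<in> gwo_hom C A B"
proof -
  interpret B: group B by (rule gwo_objectD(1)[OF assms])
  show ?thesis using zero_preserved[OF assms] by (intro gwo_homI) simp_all
qed

lemma gwo_subobject_equalizer:
  assumes A: "gwo_object C A" and B: "gwo_object C B"
    and h: "h \<in> gwo_hom C A B" and k: "k \<in> gwo_hom C A B"
  shows "gwo_subobject C {a \<in> carrier A. h a = k a} A"
proof -
  interpret A: group A by (rule gwo_objectD(1)[OF A])
  note hk = gwo_homD[OF h] gwo_homD[OF k] gwo_hom_one[OF A B h] gwo_hom_one[OF A B k]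
    gwo_hom_inv[OF A B h] gwo_hom_inv[OF A B k]
  have "subgroup {a \<in> carrier A. h a = k a} A"
    using hk by (intro A.subgroupI) auto
  moreover have "closed_ops C A {a \<in> carrier A. h a = k a}"
    using hk gwo_objectD(2,3)[OF A] by (auto simp: closed_ops_def)
  ultimately show ?thesis by (simp add: gwo_subobject_def)
qed

text \<open>
  Neither side is assumed to satisfy the identities: the lemma serves to carry them from the target to
  the source (\<open>gwo_object_jointly_injective\<close>) and from the source to the target (\<open>gwo_quotient\<close>).
\<close>

lemma gterm_eval_hom:
  assumes A: "group A" "closed_ops C A (carrier A)" and B: "group B"
    and h: "h \<in> gwo_hom C A B"
    and t: "wf_gterm (unary_ops C) (binary_ops C) t" and v: "\<And>n. v n \<in> carrier A"
  shows "gterm_eval A v t \<in> carrier A \<and> h (gterm_eval A v t) = gterm_eval B (\<lambda>n. h (v n)) t"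
proof -
  interpret group_hom A B h
    using A B h by (simp add: group_hom_def group_hom_axioms_def gwo_hom_def)
  show ?thesis
    using t by (induction t) (use A(2) v gwo_homD[OF h] in \<open>auto simp: closed_ops_def\<close>)
qed

context groups_with_operations
begin

text \<open>
  An identity of the targets can be checked after applying \<open>h\<close> and \<open>k\<close>. This is the common
  reason why subobjects and products inherit the identities.
\<close>

lemma gwo_object_jointly_injective:
  assumes A: "group A" "closed_ops C A (carrier A)"
    and B: "gwo_object C B" and D: "gwo_object C D"
    and h: "h \<in> gwo_hom C A B" and k: "k \<in> gwo_hom C A D"
    and inj: "\<And>a b. \<lbrakk>a \<in> carrier A; b \<in> carrier A; h a = h b; k a = k b\<rbrakk> \<Longrightarrow> a = b"
  shows "gwo_object C A"
proof -
  have "gterm_eval A v s = gterm_eval A v t"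
    if st: "(s, t) \<in> identities C" and v: "\<And>n. v n \<in> carrier A" for s t v
  proof -
    note wfs = wf[OF st, THEN conjunct1] and wft = wf[OF st, THEN conjunct2]
    note hev = gterm_eval_hom[OF A gwo_objectD(1)[OF B] h _ v]
    note kev = gterm_eval_hom[OF A gwo_objectD(1)[OF D] k _ v]
    have "gterm_eval B (\<lambda>n. h (v n)) s = gterm_eval B (\<lambda>n. h (v n)) t"
      by (rule gwo_objectD(4)[OF B st]) (rule gwo_homD(1)[OF h v])
    moreover have "gterm_eval D (\<lambda>n. k (v n)) s = gterm_eval D (\<lambda>n. k (v n)) t"
      by (rule gwo_objectD(4)[OF D st]) (rule gwo_homD(1)[OF k v])
    ultimately show ?thesis
      using hev[OF wfs] hev[OF wft] kev[OF wfs] kev[OF wft] by (intro inj) simp_all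
  qed
  then show ?thesis using A by (auto simp: gwo_object_def)
qed

lemma gwo_object_restrict:
  assumes A: "gwo_object C A" and S: "gwo_subobject C S A"
  shows "gwo_object C (gwo_restrict A S)"
proof -
  have sub: "subgroup S A" and cl: "closed_ops C A S" using S by (auto simp: gwo_subobject_def)
  have grp: "group (gwo_restrict A S)"
    unfolding gwo_restrict_def using sub gwo_objectD(1)[OF A]
    by (rule subgroup.subgroup_is_group)
  have incl: "(\<lambda>a. a) \<in> gwo_hom C (gwo_restrict A S) A"
    using subgroup.subset[OF sub] by (intro gwo_homI) auto
  show ?thesis
    by (rule gwo_object_jointly_injective[OF grp _ A A incl incl])
      (use cl in \<open>auto simp: closed_ops_def\<close>)
qed

lemma gwo_object_prod:
  assumes A: "gwo_object C A" and B: "gwo_object C B"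
  shows "gwo_object C (gwo_prod A B)"
proof -
  interpret A: group A by (rule gwo_objectD(1)[OF A])
  interpret B: group B by (rule gwo_objectD(1)[OF B])
  have grp: "group (gwo_prod A B)"
  proof (rule groupI)
    fix s assume "s \<in> carrier (gwo_prod A B)"
    then show "\<exists>t\<in>carrier (gwo_prod A B). t \<otimes>\<^bsub>gwo_prod A B\<^esub> s = \<one>\<^bsub>gwo_prod A B\<^esub>"
      by (intro bexI[of _ "(inv\<^bsub>A\<^esub> fst s, inv\<^bsub>B\<^esub> snd s)"]) auto
  qed (auto simp: A.m_assoc B.m_assoc)
  show ?thesis
    by (rule gwo_object_jointly_injective[OF grp _ A B gwo_hom_fst gwo_hom_snd])
      (use gwo_objectD(2,3)[OF A] gwo_objectD(2,3)[OF B] in \<open>auto simp: closed_ops_def\<close>)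
qed

text \<open>
  The pullback is the equalizer of two homomorphisms on the product.
\<close>

lemma gwo_object_pullback:
  assumes A: "gwo_object C A" and B: "gwo_object C B" and D: "gwo_object C D"
    and h: "h \<in> gwo_hom C A D" and k: "k \<in> gwo_hom C B D"
  shows "gwo_object C
    (gwo_restrict (gwo_prod A B) {(a, b). a \<in> carrier A \<and> b \<in> carrier B \<and> h a = k b})"
proof -
  have "{(a, b). a \<in> carrier A \<and> b \<in> carrier B \<and> h a = k b} =
      {s \<in> carrier (gwo_prod A B). h (fst s) = k (snd s)}"
    by auto
  then show ?thesis
    using gwo_object_restrict[OF gwo_object_prod[OF A B]
        gwo_subobject_equalizer[OF gwo_object_prod[OF A B] D
          gwo_hom_comp[OF gwo_hom_fst h] gwo_hom_comp[OF gwo_hom_snd k]]]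
    by simp
qed

text \<open>
  A congruence, given as the kernel of a map \<open>q\<close>, makes the image of \<open>q\<close> an object with \<open>q\<close> a
  homomorphism. Identities hold in the image because every valuation there lifts along \<open>q\<close>. Compatibility
  with negation follows from that with addition.
\<close>

lemma gwo_quotient:
  fixes S :: "('c, 'u, 'b) gwo" and q :: "'c \<Rightarrow> 'd"
  assumes S: "gwo_object C S"
    and mult: "\<And>a a' b b'. \<lbrakk>a \<in> carrier S; a' \<in> carrier S; b \<in> carrier S; b' \<in> carrier S;
      q a = q a'; q b = q b'\<rbrakk> \<Longrightarrow> q (a \<otimes>\<^bsub>S\<^esub> b) = q (a' \<otimes>\<^bsub>S\<^esub> b')"
    and un: "\<And>w a a'. \<lbrakk>w \<in> unary_ops C; a \<in> carrier S; a' \<in> carrier S; q a = q a'\<rbrakk> \<Longrightarrow>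
      q (un S w a) = q (un S w a')"
    and bin: "\<And>f a a' b b'. \<lbrakk>f \<in> binary_ops C; a \<in> carrier S; a' \<in> carrier S;
      b \<in> carrier S; b' \<in> carrier S; q a = q a'; q b = q b'\<rbrakk> \<Longrightarrow>
      q (bin S f a b) = q (bin S f a' b')"
  obtains B :: "('d, 'u, 'b) gwo"
  where "gwo_object C B" "carrier B = q ` carrier S" "q \<in> gwo_hom C S B"
proof -
  interpret S: group S by (rule gwo_objectD(1)[OF S])
  \<comment> \<open>a choice of representatives; by the congruence hypotheses no operation depends on it\<close>
  define s where "s = inv_into (carrier S) q"
  have s: "s (q a) \<in> carrier S" "q (s (q a)) = q a" if "a \<in> carrier S" for a
    using that by (auto simp: s_def inv_into_into f_inv_into_f)
  define B :: "('d, 'u, 'b) gwo" where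
    "B = \<lparr>carrier = q ` carrier S, mult = (\<lambda>x y. q (s x \<otimes>\<^bsub>S\<^esub> s y)), one = q \<one>\<^bsub>S\<^esub>,
      un = (\<lambda>w x. q (un S w (s x))), bin = (\<lambda>f x y. q (bin S f (s x) (s y)))\<rparr>"
  have B: "carrier B = q ` carrier S" "one B = q \<one>\<^bsub>S\<^esub>" by (simp_all add: B_def)
  have hom: "q \<in> gwo_hom C S B"
    by (rule gwo_homI) (auto simp: B_def s intro!: mult un bin)
  note q = gwo_homD(2-4)[OF hom, symmetric]
  have grp: "group B"
  proof (rule groupI)
    fix x assume "x \<in> carrier B"
    then obtain a where a: "a \<in> carrier S" "x = q a" by (auto simp: B)
    then show "\<exists>y\<in>carrier B. y \<otimes>\<^bsub>B\<^esub> x = \<one>\<^bsub>B\<^esub>"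
      by (intro bexI[of _ "q (inv\<^bsub>S\<^esub> a)"]) (auto simp: B q)
  qed (auto simp: B q S.m_assoc)
  have closed: "closed_ops C B (carrier B)"
    using gwo_objectD(2,3)[OF S] by (auto simp: closed_ops_def B q)
  have "gterm_eval B v l = gterm_eval B v r"
    if lr: "(l, r) \<in> identities C" and v: "\<And>n. v n \<in> carrier B" for l r v
  proof -
    have sv: "s (v n) \<in> carrier S" "q (s (v n)) = v n" for n
      using v[of n] s by (auto simp: B)
    have "q (gterm_eval S (\<lambda>n. s (v n)) t) = gterm_eval B v t"
      if "wf_gterm (unary_ops C) (binary_ops C) t" for t
      using gterm_eval_hom[OF _ _ grp hom that, of "\<lambda>n. s (v n)"] S sv
      by (simp add: gwo_object_def)
    then show ?thesis
      using gwo_objectD(4)[OF S lr, of "\<lambda>n. s (v n)", OF sv(1)] wf[OF lr] by metis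
  qed
  then have "gwo_object C B" using grp closed by (auto simp: gwo_object_def)
  then show thesis using that B(1) hom by blast
qed

end

text \<open>
  Universal property of the quotient: it reduces a claim about the carrier of \<open>B\<close>, whose operations
  are known only through \<open>q\<close>, to one about \<open>S\<close>.
\<close>

lemma gwo_hom_factor:
  assumes S: "gwo_object C S" and q: "q \<in> gwo_hom C S B" "carrier B = q ` carrier S"
    and hq: "(\<lambda>s. h (q s)) \<in> gwo_hom C S D"
  shows "h \<in> gwo_hom C B D"
proof -
  interpret S: group S by (rule gwo_objectD(1)[OF S])
  note hom = gwo_homD(2-4)[OF q(1), symmetric] gwo_homD[OF hq]
  show ?thesis
    using gwo_objectD(2,3)[OF S] hom by (intro gwo_homI) (auto simp: q(2))
qed

text \<open>
  The counterpart for maps into \<open>D\<close>: both sides of each homomorphism equation agree after \<open>k\<close> and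
  after \<open>l\<close>.
\<close>

lemma gwo_hom_jointly_injective:
  assumes D: "gwo_object C D"
    and k: "k \<in> gwo_hom C D M" and l: "l \<in> gwo_hom C D N"
    and inj: "\<And>x y. \<lbrakk>x \<in> carrier D; y \<in> carrier D; k x = k y; l x = l y\<rbrakk> \<Longrightarrow> x = y"
    and B: "gwo_object C B" and h: "\<And>b. b \<in> carrier B \<Longrightarrow> h b \<in> carrier D"
    and kh: "(\<lambda>b. k (h b)) \<in> gwo_hom C B M" and lh: "(\<lambda>b. l (h b)) \<in> gwo_hom C B N"
  shows "h \<in> gwo_hom C B D"
proof -
  interpret D: group D by (rule gwo_objectD(1)[OF D])
  interpret B: group B by (rule gwo_objectD(1)[OF B])
  note facts = h gwo_objectD(2,3)[OF D] gwo_objectD(2,3)[OF B]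
    gwo_homD(2-4)[OF k] gwo_homD(2-4)[OF l] gwo_homD(2-4)[OF kh] gwo_homD(2-4)[OF lh]
  show ?thesis by (rule gwo_homI) (auto intro!: inj simp: facts)
qed

section \<open>Lifting along a covering morphism\<close>

locale pointed_covering = G: groupoid G + H: groupoid H
  for G :: "('a, 'o) groupoid_data" and H :: "('c, 'q) groupoid_data" +
  fixes z :: 'q and y :: 'o and p :: "'c \<Rightarrow> 'a" and p0 :: "'q \<Rightarrow> 'o"
  assumes covering: "pointed_covering_morphism H z G y p p0"
    and transitive: "transitive_groupoid H"
begin

lemma base: "z \<in> objs H" "y \<in> objs G" "p0 z = y"
  using covering by (auto simp: pointed_covering_morphism_def)

lemma morphism: "groupoid_morphism H G p p0"
  using covering by (simp add: pointed_covering_morphism_def covering_morphism_def)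

lemma p_closed: "h \<in> elts H \<Longrightarrow> p h \<in> elts G"
  and d0_p: "h \<in> elts H \<Longrightarrow> d0 G (p h) = p0 (d0 H h)"
  and d1_p: "h \<in> elts H \<Longrightarrow> d1 G (p h) = p0 (d1 H h)"
  and p_eps: "x \<in> objs H \<Longrightarrow> p (eps H x) = eps G (p0 x)"
  and p_cmp: "\<lbrakk>h \<in> elts H; k \<in> elts H; d1 H h = d0 H k\<rbrakk> \<Longrightarrow> p (cmp H h k) = cmp G (p h) (p k)"
  using morphism by (auto simp: groupoid_morphism_def)

lemma star_bij: "x \<in> objs H \<Longrightarrow> bij_betw p (star H x) (star G (p0 x))"
  using covering by (simp add: pointed_covering_morphism_def covering_morphism_def)

lemma eq_if_d0_p_eq:
  assumes "h \<in> elts H" "k \<in> elts H" "d0 H h = d0 H k" "p h = p k"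
  shows "h = k"
  using star_bij[OF H.d0_closed[OF assms(1)]] assms
  by (auto simp: bij_betw_def star_def dest: inj_onD)

definition lift :: "'q \<Rightarrow> 'a \<Rightarrow> 'c" where
  "lift x = the_inv_into (star H x) p"

lemma lift:
  assumes "x \<in> objs H" "g \<in> elts G" "d0 G g = p0 x"
  shows lift_closed: "lift x g \<in> elts H" and d0_lift: "d0 H (lift x g) = x"
    and p_lift: "p (lift x g) = g"
proof -
  have "g \<in> p ` star H x" and inj: "inj_on p (star H x)"
    using star_bij[OF assms(1)] assms by (auto simp: bij_betw_def star_def)
  then show "lift x g \<in> elts H" "d0 H (lift x g) = x" "p (lift x g) = g"
    using the_inv_into_into[OF inj, of g "star H x"] f_the_inv_into_f[OF inj, of g]
    by (auto simp: lift_def star_def)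
qed

lemma lift_p:
  assumes "h \<in> elts H"
  shows "lift (d0 H h) (p h) = h"
  using assms by (intro eq_if_d0_p_eq) (simp_all add: lift H.d0_closed p_closed d0_p)

definition endpoint :: "'a \<Rightarrow> 'q" where
  "endpoint a = d1 H (lift z a)"

lemma endpoint:
  assumes "a \<in> star G y"
  shows endpoint_closed: "endpoint a \<in> objs H" and p0_endpoint: "p0 (endpoint a) = d1 G a"
  using assms lift[OF base(1), of a] d1_p[of "lift z a"]
  by (auto simp: star_def base endpoint_def H.d1_closed)

lemma endpoint_p:
  assumes "h \<in> elts H" "d0 H h = z"
  shows "endpoint (p h) = d1 H h"
  using lift_p[OF assms(1)] assms(2) by (simp add: endpoint_def)

text \<open>
  The lift of a composite is the composite of the lifts, the second one taken at the endpoint of the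
  first.
\<close>

lemma endpoint_cmp:
  assumes a: "a \<in> star G y" and g: "g \<in> elts G" "d1 G a = d0 G g"
  shows "endpoint (cmp G a g) = d1 H (lift (endpoint a) g)"
proof -
  have la: "lift z a \<in> elts H" "d0 H (lift z a) = z" "p (lift z a) = a"
    using a lift[OF base(1), of a] by (auto simp: star_def base)
  have lg: "lift (endpoint a) g \<in> elts H" "d0 H (lift (endpoint a) g) = endpoint a"
    "p (lift (endpoint a) g) = g"
    using lift[of "endpoint a" g] endpoint[OF a] g by auto
  have c: "d1 H (lift z a) = d0 H (lift (endpoint a) g)" using lg by (simp add: endpoint_def)
  show ?thesis
    using endpoint_p[of "cmp H (lift z a) (lift (endpoint a) g)"] c la lg
    by (simp add: p_cmp H.cmp_closed H.d0_cmp H.d1_cmp)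
qed

text \<open>
  This is where transitivity of the covering groupoid enters: objects outside the component of \<open>z\<close> are
  not reached by lifts.
\<close>

lemma endpoint_image: "endpoint ` star G y = objs H"
proof
  show "endpoint ` star G y \<subseteq> objs H" using endpoint_closed by blast
  show "objs H \<subseteq> endpoint ` star G y"
  proof
    fix x assume "x \<in> objs H"
    then obtain h where h: "h \<in> elts H" "d0 H h = z" "d1 H h = x"
      using transitive base by (auto simp: transitive_groupoid_def hom_set_def)
    then have "p h \<in> star G y" by (simp add: star_def p_closed d0_p base)
    then show "x \<in> endpoint ` star G y" using endpoint_p[OF h(1,2)] h(3) by force
  qed
qed

text \<open>
  If the lifts of \<open>a\<close> and \<open>b\<close> end at the same object, the first followed by the inverse of the second
  is a loop at \<open>z\<close>, whose image is the required \<open>c\<close>. Conversely, \<open>c\<close> lifts to a loop at \<open>z\<close>, so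
  composing it with the lift of \<open>b\<close> gives the lift of \<open>c \<circ> b\<close>.
\<close>

lemma endpoint_eq_iff:
  assumes a: "a \<in> star G y" and b: "b \<in> star G y"
  shows "endpoint a = endpoint b \<longleftrightarrow> (\<exists>c \<in> characteristic_group H p z. a = cmp G c b)"
proof -
  have la: "lift z a \<in> elts H" "d0 H (lift z a) = z" "p (lift z a) = a"
    and lb: "lift z b \<in> elts H" "d0 H (lift z b) = z" "p (lift z b) = b"
    using a b lift[OF base(1)] by (auto simp: star_def base)
  show ?thesis
  proof
    assume eq: "endpoint a = endpoint b"
    obtain k where k: "k \<in> elts H" "d0 H k = d1 H (lift z b)" "d1 H k = z"
      "cmp H k (lift z b) = eps H (d1 H (lift z b))"
      using H.inverse[OF lb(1)] lb(2) by auto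
    \<comment> \<open>\<open>k\<close> is the inverse of the lift of \<open>b\<close>, so this is a loop at \<open>z\<close>\<close>
    let ?c = "cmp H (lift z a) k"
    have d: "d1 H (lift z a) = d0 H k" using eq k by (simp add: endpoint_def)
    have c: "?c \<in> object_group H z"
      using d la k by (simp add: hom_set_def H.cmp_closed H.d0_cmp H.d1_cmp)
    have "cmp H ?c (lift z b) = cmp H (lift z a) (cmp H k (lift z b))"
      using d la lb k by (intro H.cmp_assoc) auto
    also have "\<dots> = lift z a"
      using H.cmp_eps[OF la(1)] k d by simp
    finally have "a = cmp G (p ?c) b"
      using p_cmp[of ?c "lift z b"] c la lb by (simp add: hom_set_def)
    then show "\<exists>c \<in> characteristic_group H p z. a = cmp G c b"
      using c by (auto simp: characteristic_group_def)
  next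
    assume "\<exists>c \<in> characteristic_group H p z. a = cmp G c b"
    then obtain k where k: "k \<in> elts H" "d0 H k = z" "d1 H k = z" "a = cmp G (p k) b"
      by (auto simp: characteristic_group_def hom_set_def)
    then have "a = p (cmp H k (lift z b))" using lb by (simp add: p_cmp)
    then show "endpoint a = endpoint b"
      using endpoint_p[of "cmp H k (lift z b)"] k lb
      by (simp add: H.cmp_closed H.d0_cmp H.d1_cmp endpoint_def)
  qed
qed

end

section \<open>The internal structure on the covering groupoid\<close>

text \<open>
  The interchange law: that composition is a homomorphism on composable pairs says that it commutes with
  every operation.
\<close>

lemma internal_groupoid_interchange:
  assumes "internal_groupoid C G A A0"
    and "a \<in> elts G" "g \<in> elts G" "d1 G a = d0 G g"
  shows "\<lbrakk>b \<in> elts G; h \<in> elts G; d1 G b = d0 G h\<rbrakk> \<Longrightarrow>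
      cmp G (a \<otimes>\<^bsub>A\<^esub> b) (g \<otimes>\<^bsub>A\<^esub> h) = cmp G a g \<otimes>\<^bsub>A\<^esub> cmp G b h"
    and "w \<in> unary_ops C \<Longrightarrow> cmp G (un A w a) (un A w g) = un A w (cmp G a g)"
    and "\<lbrakk>f \<in> binary_ops C; b \<in> elts G; h \<in> elts G; d1 G b = d0 G h\<rbrakk> \<Longrightarrow>
      cmp G (bin A f a b) (bin A f g h) = bin A f (cmp G a g) (cmp G b h)"
proof -
  have "(\<lambda>(a, b). cmp G a b) \<in> gwo_hom C (composable_pairs G A) A"
    using assms(1) by (simp add: internal_groupoid_def)
  note c = gwo_homD(2-4)[OF this, unfolded composable_pairs_def, simplified]
  show "\<lbrakk>b \<in> elts G; h \<in> elts G; d1 G b = d0 G h\<rbrakk> \<Longrightarrow>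
      cmp G (a \<otimes>\<^bsub>A\<^esub> b) (g \<otimes>\<^bsub>A\<^esub> h) = cmp G a g \<otimes>\<^bsub>A\<^esub> cmp G b h"
    using c(1)[of "(a, g)" "(b, h)"] assms(2-) by simp
  show "w \<in> unary_ops C \<Longrightarrow> cmp G (un A w a) (un A w g) = un A w (cmp G a g)"
    using c(2)[of w "(a, g)"] assms(2-) by simp
  show "\<lbrakk>f \<in> binary_ops C; b \<in> elts G; h \<in> elts G; d1 G b = d0 G h\<rbrakk> \<Longrightarrow>
      cmp G (bin A f a b) (bin A f g h) = bin A f (cmp G a g) (cmp G b h)"
    using c(3)[of f "(a, g)" "(b, h)"] assms(2-) by simp
qed

locale internal_covering = groups_with_operations C + pointed_covering G H z "\<one>\<^bsub>A0\<^esub>" p p0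
  for C :: "('u, 'b) gwo_theory"
    and G :: "('a, 'o) groupoid_data" and A :: "('a, 'u, 'b) gwo" and A0 :: "('o, 'u, 'b) gwo"
    and H :: "('c, 'q) groupoid_data" and z p p0 +
  assumes internal: "internal_groupoid C G A A0"
    and characteristic: "gwo_subobject C (characteristic_group H p z)
      (gwo_restrict A (object_group G \<one>\<^bsub>A0\<^esub>))"
begin

lemma objects: "gwo_object C A" "gwo_object C A0"
  and carriers [simp]: "carrier A = elts G" "carrier A0 = objs G"
  and structure_homs: "d0 G \<in> gwo_hom C A A0" "d1 G \<in> gwo_hom C A A0" "eps G \<in> gwo_hom C A0 A"
    "(\<lambda>(a, b). cmp G a b) \<in> gwo_hom C (composable_pairs G A) A"
  using internal by (auto simp: internal_groupoid_def)

lemmas interchange = internal_groupoid_interchange[OF internal]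

text \<open>
  A group with operations because the star of \<open>0\<close> is the kernel of \<open>d0\<close>.
\<close>

definition star_object :: "('a, 'u, 'b) gwo" where
  "star_object = gwo_restrict A (star G \<one>\<^bsub>A0\<^esub>)"

lemma star_object_simps [simp]:
  "carrier star_object = star G \<one>\<^bsub>A0\<^esub>"
  "mult star_object = mult A" "one star_object = one A"
  "un star_object = un A" "bin star_object = bin A"
  by (simp_all add: star_object_def)

lemma star_object: "gwo_object C star_object"
  using gwo_object_restrict[OF objects(1)
      gwo_subobject_equalizer[OF objects structure_homs(1) gwo_hom_zero[OF objects(2)]]]
  by (simp add: star_object_def star_def)

lemma hom_from_star:
  assumes "h \<in> gwo_hom C A D"
  shows "h \<in> gwo_hom C star_object D"
  using gwo_hom_restrict[OF assms, of "star G \<one>\<^bsub>A0\<^esub>"]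
  by (auto simp: star_object_def star_def)

lemma characteristic_closed:
  shows "c \<in> characteristic_group H p z \<Longrightarrow> c \<in> object_group G \<one>\<^bsub>A0\<^esub>"
    and "\<lbrakk>c \<in> characteristic_group H p z; e \<in> characteristic_group H p z\<rbrakk> \<Longrightarrow>
      c \<otimes>\<^bsub>A\<^esub> e \<in> characteristic_group H p z"
    and "\<lbrakk>w \<in> unary_ops C; c \<in> characteristic_group H p z\<rbrakk> \<Longrightarrow>
      un A w c \<in> characteristic_group H p z"
    and "\<lbrakk>f \<in> binary_ops C; c \<in> characteristic_group H p z; e \<in> characteristic_group H p z\<rbrakk> \<Longrightarrow>
      bin A f c e \<in> characteristic_group H p z"
  using characteristic subgroup.subset subgroup.m_closed
  by (fastforce simp: gwo_subobject_def closed_ops_def)+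

text \<open>
  Having the same endpoint is a congruence on the star of \<open>0\<close>: writing \<open>a = c \<circ> a'\<close> and \<open>b = e \<circ> b'\<close>,
  the interchange law gives \<open>a + b = (c + e) \<circ> (a' + b')\<close>, where \<open>c + e\<close> is again in the
  characteristic group; the other operations behave in the same way.
\<close>

lemma endpoint_congruence:
  assumes a: "a \<in> star G \<one>\<^bsub>A0\<^esub>" "a' \<in> star G \<one>\<^bsub>A0\<^esub>" "endpoint a = endpoint a'"
  shows endpoint_un_cong: "w \<in> unary_ops C \<Longrightarrow> endpoint (un A w a) = endpoint (un A w a')"
    and endpoint_mult_cong:
      "\<lbrakk>b \<in> star G \<one>\<^bsub>A0\<^esub>; b' \<in> star G \<one>\<^bsub>A0\<^esub>; endpoint b = endpoint b'\<rbrakk> \<Longrightarrow>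
        endpoint (a \<otimes>\<^bsub>A\<^esub> b) = endpoint (a' \<otimes>\<^bsub>A\<^esub> b')"
    and endpoint_bin_cong:
      "\<lbrakk>f \<in> binary_ops C; b \<in> star G \<one>\<^bsub>A0\<^esub>; b' \<in> star G \<one>\<^bsub>A0\<^esub>; endpoint b = endpoint b'\<rbrakk> \<Longrightarrow>
        endpoint (bin A f a b) = endpoint (bin A f a' b')"
proof -
  interpret S: group star_object by (rule gwo_objectD(1)[OF star_object])
  note closed = gwo_objectD(2,3)[OF star_object, simplified] S.m_closed[simplified]
  have factor: "\<exists>c \<in> characteristic_group H p z.
      b = cmp G c b' \<and> c \<in> elts G \<and> b' \<in> elts G \<and> d1 G c = d0 G b'"
    if "b \<in> star G \<one>\<^bsub>A0\<^esub>" "b' \<in> star G \<one>\<^bsub>A0\<^esub>" "endpoint b = endpoint b'" for b b'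
    using endpoint_eq_iff[OF that(1,2)] that characteristic_closed(1)
    by (force simp: star_def hom_set_def)
  obtain c where c: "c \<in> characteristic_group H p z" "a = cmp G c a'"
    "c \<in> elts G" "a' \<in> elts G" "d1 G c = d0 G a'"
    using factor[OF a] by blast
  show "endpoint (un A w a) = endpoint (un A w a')" if w: "w \<in> unary_ops C"
    unfolding endpoint_eq_iff[OF closed(1)[OF w a(1)] closed(1)[OF w a(2)]]
    using characteristic_closed(3)[OF w c(1)] interchange(2)[OF c(3-5) w] c(2)
    by (auto intro!: bexI[of _ "un A w c"])
  fix b b' assume b: "b \<in> star G \<one>\<^bsub>A0\<^esub>" "b' \<in> star G \<one>\<^bsub>A0\<^esub>" "endpoint b = endpoint b'"
  obtain e where e: "e \<in> characteristic_group H p z" "b = cmp G e b'"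
    "e \<in> elts G" "b' \<in> elts G" "d1 G e = d0 G b'"
    using factor[OF b] by blast
  show "endpoint (a \<otimes>\<^bsub>A\<^esub> b) = endpoint (a' \<otimes>\<^bsub>A\<^esub> b')"
    unfolding endpoint_eq_iff[OF closed(3)[OF a(1) b(1)] closed(3)[OF a(2) b(2)]]
    using characteristic_closed(2)[OF c(1) e(1)] interchange(1)[OF c(3-5) e(3-5)] c(2) e(2)
    by (auto intro!: bexI[of _ "c \<otimes>\<^bsub>A\<^esub> e"])
  show "endpoint (bin A f a b) = endpoint (bin A f a' b')" if f: "f \<in> binary_ops C" for f
    unfolding endpoint_eq_iff[OF closed(2)[OF f a(1) b(1)] closed(2)[OF f a(2) b(2)]]
    using characteristic_closed(4)[OF f c(1) e(1)] interchange(3)[OF c(3-5) f e(3-5)] c(2) e(2)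
    by (auto intro!: bexI[of _ "bin A f c e"])
qed

lemma object_structure:
  obtains B0 :: "('q, 'u, 'b) gwo"
  where "gwo_object C B0" "carrier B0 = objs H" "endpoint \<in> gwo_hom C star_object B0"
proof -
  obtain B0 :: "('q, 'u, 'b) gwo"
    where "gwo_object C B0" "carrier B0 = endpoint ` carrier star_object"
      "endpoint \<in> gwo_hom C star_object B0"
    by (rule gwo_quotient[OF star_object, of endpoint])
      (auto intro: endpoint_un_cong endpoint_mult_cong endpoint_bin_cong)
  then show thesis using that by (simp add: endpoint_image)
qed

text \<open>
  Elements of \<open>H\<close> are presented by pairs \<open>(a, g)\<close>: the lift of \<open>a\<close> leads from \<open>z\<close> to the initial point of
  an element over \<open>g\<close>.
\<close>

definition path_pairs :: "('a \<times> 'a, 'u, 'b) gwo" where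
  "path_pairs = gwo_restrict (gwo_prod star_object A)
    {(a, g). a \<in> star G \<one>\<^bsub>A0\<^esub> \<and> g \<in> elts G \<and> d1 G a = d0 G g}"

lemma path_pairs_simps [simp]:
  "carrier path_pairs = {(a, g). a \<in> star G \<one>\<^bsub>A0\<^esub> \<and> g \<in> elts G \<and> d1 G a = d0 G g}"
  "mult path_pairs s t = (fst s \<otimes>\<^bsub>A\<^esub> fst t, snd s \<otimes>\<^bsub>A\<^esub> snd t)"
  "un path_pairs w s = (un A w (fst s), un A w (snd s))"
  "bin path_pairs f s t = (bin A f (fst s) (fst t), bin A f (snd s) (snd t))"
  by (simp_all add: path_pairs_def)

lemma path_pairs: "gwo_object C path_pairs"
proof -
  have "gwo_object C (gwo_restrict (gwo_prod star_object A)
      {(a, g). a \<in> carrier star_object \<and> g \<in> carrier A \<and> d1 G a = d0 G g})"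
    by (intro gwo_object_pullback[OF star_object objects] hom_from_star structure_homs)
  then show ?thesis by (simp add: path_pairs_def)
qed

lemma path_pairs_homs:
  shows "fst \<in> gwo_hom C path_pairs star_object"
    and "snd \<in> gwo_hom C path_pairs A"
    and "(\<lambda>s. cmp G (fst s) (snd s)) \<in> gwo_hom C path_pairs star_object"
proof -
  show "fst \<in> gwo_hom C path_pairs star_object" "snd \<in> gwo_hom C path_pairs A"
    by (rule gwo_homI; auto)+
  show "(\<lambda>s. cmp G (fst s) (snd s)) \<in> gwo_hom C path_pairs star_object"
    by (rule gwo_homI) (auto simp: star_def G.cmp_closed G.d0_cmp interchange)
qed

definition lift_pair :: "'a \<times> 'a \<Rightarrow> 'c" where
  "lift_pair s = lift (endpoint (fst s)) (snd s)"

lemma lift_pair: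
  assumes "s \<in> carrier path_pairs"
  shows lift_pair_closed: "lift_pair s \<in> elts H"
    and d0_lift_pair: "d0 H (lift_pair s) = endpoint (fst s)"
    and d1_lift_pair: "d1 H (lift_pair s) = endpoint (cmp G (fst s) (snd s))"
    and p_lift_pair: "p (lift_pair s) = snd s"
  using assms endpoint[of "fst s"] lift[of "endpoint (fst s)" "snd s"]
    endpoint_cmp[of "fst s" "snd s"]
  by (auto simp: lift_pair_def)

lemma lift_pair_image: "lift_pair ` carrier path_pairs = elts H"
proof
  show "lift_pair ` carrier path_pairs \<subseteq> elts H" using lift_pair_closed by blast
  show "elts H \<subseteq> lift_pair ` carrier path_pairs"
  proof
    fix h assume h: "h \<in> elts H"
    then obtain a where a: "a \<in> star G \<one>\<^bsub>A0\<^esub>" "endpoint a = d0 H h"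
      using endpoint_image H.d0_closed[OF h] by (metis imageE)
    have "(a, p h) \<in> carrier path_pairs"
      using a h p0_endpoint[OF a(1)] by (simp add: p_closed d0_p)
    moreover have "lift_pair (a, p h) = h" using lift_p[OF h] a(2) by (simp add: lift_pair_def)
    ultimately show "h \<in> lift_pair ` carrier path_pairs" by (metis imageI)
  qed
qed

text \<open>
  Hence equality of lifts is a congruence on path pairs: it is one in each coordinate.
\<close>

lemma lift_pair_eq_iff:
  assumes "s \<in> carrier path_pairs" "t \<in> carrier path_pairs"
  shows "lift_pair s = lift_pair t \<longleftrightarrow> endpoint (fst s) = endpoint (fst t) \<and> snd s = snd t"
  using lift_pair[OF assms(1)] lift_pair[OF assms(2)] by (metis lift_pair_def)

lemma element_structure:
  obtains B :: "('c, 'u, 'b) gwo"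
  where "gwo_object C B" "carrier B = elts H" "lift_pair \<in> gwo_hom C path_pairs B"
proof -
  interpret P: group path_pairs by (rule gwo_objectD(1)[OF path_pairs])
  note closed = P.m_closed gwo_objectD(2,3)[OF path_pairs]
  obtain B :: "('c, 'u, 'b) gwo"
    where "gwo_object C B" "carrier B = lift_pair ` carrier path_pairs"
      "lift_pair \<in> gwo_hom C path_pairs B"
  proof (rule gwo_quotient[OF path_pairs, of lift_pair])
    fix s s' t t' assume st: "s \<in> carrier path_pairs" "s' \<in> carrier path_pairs"
      "t \<in> carrier path_pairs" "t' \<in> carrier path_pairs"
      "lift_pair s = lift_pair s'" "lift_pair t = lift_pair t'"
    then show "lift_pair (s \<otimes>\<^bsub>path_pairs\<^esub> t) = lift_pair (s' \<otimes>\<^bsub>path_pairs\<^esub> t')"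
      unfolding lift_pair_eq_iff[OF closed(1)[OF st(1,3)] closed(1)[OF st(2,4)]]
      by (auto simp: lift_pair_eq_iff[OF st(1,2)] lift_pair_eq_iff[OF st(3,4)]
          intro: endpoint_mult_cong)
    fix f assume f: "f \<in> binary_ops C"
    show "lift_pair (bin path_pairs f s t) = lift_pair (bin path_pairs f s' t')"
      unfolding lift_pair_eq_iff[OF closed(3)[OF f st(1,3)] closed(3)[OF f st(2,4)]]
      using st f by (auto simp: lift_pair_eq_iff[OF st(1,2)] lift_pair_eq_iff[OF st(3,4)]
          intro: endpoint_bin_cong)
  next
    fix w s s' assume w: "w \<in> unary_ops C" and s: "s \<in> carrier path_pairs"
      "s' \<in> carrier path_pairs" "lift_pair s = lift_pair s'"
    then show "lift_pair (un path_pairs w s) = lift_pair (un path_pairs w s')"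
      unfolding lift_pair_eq_iff[OF closed(2)[OF w s(1)] closed(2)[OF w s(2)]]
      by (auto simp: lift_pair_eq_iff[OF s(1,2)] intro: endpoint_un_cong)
  qed
  then show thesis by (intro that) (simp_all only: lift_pair_image)
qed

lemma internal_structure_lifts:
  obtains B :: "('c, 'u, 'b) gwo" and B0 :: "('q, 'u, 'b) gwo"
  where "internal_groupoid C H B B0" "internal_groupoid_morphism C H B B0 G A A0 p p0"
    "\<one>\<^bsub>B0\<^esub> = z"
proof -
  obtain B0 :: "('q, 'u, 'b) gwo"
    where B0: "gwo_object C B0" "carrier B0 = objs H" "endpoint \<in> gwo_hom C star_object B0"
    by (rule object_structure)
  obtain B :: "('c, 'u, 'b) gwo"
    where B: "gwo_object C B" "carrier B = elts H" "lift_pair \<in> gwo_hom C path_pairs B"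
    by (rule element_structure)
  have B_img: "carrier B = lift_pair ` carrier path_pairs" by (simp only: B(2) lift_pair_image)
  \<comment> \<open>the zero of the star is the identity at \<open>0\<close>, whose lift at \<open>z\<close> is the identity at \<open>z\<close>\<close>
  have "\<one>\<^bsub>A\<^esub> = eps G \<one>\<^bsub>A0\<^esub>"
    using gwo_hom_one[OF objects(2,1) structure_homs(3)] by simp
  also have "\<dots> = p (eps H z)" by (simp add: p_eps base)
  finally have zero: "\<one>\<^bsub>B0\<^esub> = z"
    using gwo_hom_one[OF star_object B0(1,3)]
    by (simp add: endpoint_p base H.eps_closed H.d0_eps H.d1_eps)
  have p: "p \<in> gwo_hom C B A"
    by (rule gwo_hom_factor[OF path_pairs B(3) B_img])
      (rule gwo_hom_cong[OF path_pairs path_pairs_homs(2) p_lift_pair])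
  have d0: "d0 H \<in> gwo_hom C B B0"
    by (rule gwo_hom_factor[OF path_pairs B(3) B_img])
      (rule gwo_hom_cong[OF path_pairs gwo_hom_comp[OF path_pairs_homs(1) B0(3)] d0_lift_pair])
  have d1: "d1 H \<in> gwo_hom C B B0"
    by (rule gwo_hom_factor[OF path_pairs B(3) B_img])
      (rule gwo_hom_cong[OF path_pairs gwo_hom_comp[OF path_pairs_homs(3) B0(3)] d1_lift_pair])
  have p0: "p0 \<in> gwo_hom C B0 A0"
  proof (rule gwo_hom_factor[OF star_object B0(3)])
    show "carrier B0 = endpoint ` carrier star_object" by (simp add: B0(2) endpoint_image)
    show "(\<lambda>a. p0 (endpoint a)) \<in> gwo_hom C star_object A0"
      by (rule gwo_hom_cong[OF star_object hom_from_star[OF structure_homs(2)]])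
        (simp add: p0_endpoint)
  qed
  note into_B = gwo_hom_jointly_injective[OF B(1) d0 p, unfolded B(2), OF eq_if_d0_p_eq]
  have eps: "eps H \<in> gwo_hom C B0 B"
  proof (rule into_B[OF _ _ _ _ B0(1)])
    show "(\<lambda>x. d0 H (eps H x)) \<in> gwo_hom C B0 B0"
      by (rule gwo_hom_cong[OF B0(1), where h = "\<lambda>x. x"])
        (auto intro: gwo_homI simp: B0 H.d0_eps)
    show "(\<lambda>x. p (eps H x)) \<in> gwo_hom C B0 A"
      by (rule gwo_hom_cong[OF B0(1) gwo_hom_comp[OF p0 structure_homs(3)]])
        (simp add: B0 p_eps)
  qed (auto simp: B0 H.eps_closed)
  have pairs: "gwo_object C (composable_pairs H B)"
    using gwo_object_pullback[OF B(1,1) B0(1) d1 d0] by (simp add: composable_pairs_def B)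
  have cmp: "(\<lambda>(h, k). cmp H h k) \<in> gwo_hom C (composable_pairs H B) B"
  proof (rule into_B[OF _ _ _ _ pairs])
    have "fst \<in> gwo_hom C (composable_pairs H B) B"
      by (rule gwo_homI) (auto simp: composable_pairs_def B)
    then show "(\<lambda>s. d0 H (case s of (h, k) \<Rightarrow> cmp H h k)) \<in> gwo_hom C (composable_pairs H B) B0"
      by (rule gwo_hom_cong[OF pairs gwo_hom_comp[OF _ d0]])
        (auto simp: composable_pairs_def H.d0_cmp)
    have "map_prod p p \<in> gwo_hom C (composable_pairs H B) (composable_pairs G A)"
      using gwo_homD[OF p, unfolded B(2)]
      by (intro gwo_homI) (auto simp: composable_pairs_def p_closed d0_p d1_p)
    then show "(\<lambda>s. p (case s of (h, k) \<Rightarrow> cmp H h k)) \<in> gwo_hom C (composable_pairs H B) A"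
      by (rule gwo_hom_cong[OF pairs gwo_hom_comp[OF _ structure_homs(4)]])
        (auto simp: composable_pairs_def p_cmp)
  qed (auto simp: composable_pairs_def H.cmp_closed)
  show thesis
    by (rule that[of B B0])
      (simp_all add: internal_groupoid_def internal_groupoid_morphism_def H.groupoid_axioms
        morphism zero p p0 d0 d1 eps cmp B B0)
qed

end

theorem theorem3p5:
  fixes C :: "('u, 'b) gwo_theory"
    and G :: "('a, 'o) groupoid_data" and A :: "('a, 'u, 'b) gwo" and A0 :: "('o, 'u, 'b) gwo"
    and Gt :: "('c, 'q) groupoid_data" and zt :: 'q
    and p :: "'c \<Rightarrow> 'a" and p0 :: "'q \<Rightarrow> 'o"
  assumes "groups_with_operations C"
    and "groupoid Gt"
    and "transitive_groupoid Gt"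
    and "internal_groupoid C G A A0"
    and "transitive_groupoid G"
    and "pointed_covering_morphism Gt zt G \<one>\<^bsub>A0\<^esub> p p0"
    and "gwo_subobject C (characteristic_group Gt p zt)
           (gwo_restrict A (object_group G \<one>\<^bsub>A0\<^esub>))"
  shows "\<exists>(B :: ('c, 'u, 'b) gwo) (B0 :: ('q, 'u, 'b) gwo).
           internal_groupoid C Gt B B0 \<and>
           internal_groupoid_morphism C Gt B B0 G A A0 p p0 \<and>
           \<one>\<^bsub>B0\<^esub> = zt"
proof -
  interpret internal_covering C G A A0 Gt zt p p0
    using assms
    by (simp add: internal_covering_def internal_covering_axioms_def pointed_covering_def
        pointed_covering_axioms_def internal_groupoid_def)
  show ?thesis using internal_structure_lifts by metis
qed

end
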